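(* Let $S(t)$ be a $C^1$ curve in $CS^d_n$ defined on an interval $I$. Let $\Omega$ be an open set in $\mathbb{R}^d$ with $\sigma(S(t))\subset\Omega$ for all $t\in I$. If $f\in C^1(\Omega,\mathbb{R})$ and $F$ is the matrix function induced by $f$, then $\frac{d}{dt}F(S(t))|_{t=t^*}$ is continuous as a function of $t^*$ on $I$.
   Context: $CS^d_n$ is the set of $d$-tuples $S=(S^1,\dots,S^d)$ of pairwise-commuting $n\times n$ self-adjoint (complex Hermitian) matrices; a curve in $CS^d_n$ is $C^1$ if it is continuously differentiable as a map into the space of $d$-tuples of self-adjoint matrices. For $S\in CS^d_n$ there is a unitary $U$ with $S^r=U\operatorname{diag}(x_1^r,\dots,x_n^r)U^*$ for all $1\le r\le d$; the joint spectrum is $\sigma(S):=\{x_i=(x_i^1,\dots,x_i^d):1\le i\le n\}\subset\mathbb{R}^d$. A function $f:\Omega\to\mathbb{R}$ induces the matrix function $F$ defined on all $S\in CS^d_n$ with $\sigma(S)\subset\Omega$ by $F(S):=U\operatorname{diag}(f(x_1),\dots,f(x_n))U^*$. *)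

theory Defs
  imports "HOL-Analysis.Analysis"
begin

definition adjoint_matrix :: "complex^'n^'m \<Rightarrow> complex^'m^'n" where
  "adjoint_matrix A = (\<chi> i j. cnj (A $ j $ i))"

definition hermitian_matrix :: "complex^'n^'n \<Rightarrow> bool" where
  "hermitian_matrix A \<longleftrightarrow> adjoint_matrix A = A"

definition unitary_matrix :: "complex^'n^'n \<Rightarrow> bool" where
  "unitary_matrix U \<longleftrightarrow> adjoint_matrix U ** U = mat 1 \<and> U ** adjoint_matrix U = mat 1"

definition diag_matrix :: "('n \<Rightarrow> real) \<Rightarrow> complex^'n^'n" where
  "diag_matrix a = (\<chi> i j. if i = j then complex_of_real (a i) else 0)"

text \<open>The set $CS^d_n$, with $n$ and $d$ the cardinalities of the index types; the
  entry \<open>S $ r\<close> of a tuple is the matrix written $S^r$.\<close>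

definition commuting_selfadjoint :: "(complex^'n^'n^'d) set" where
  "commuting_selfadjoint =
     {S. (\<forall>r. hermitian_matrix (S $ r)) \<and> (\<forall>r s. S $ r ** S $ s = S $ s ** S $ r)}"

definition jointly_diagonalizes ::
    "complex^'n^'n \<Rightarrow> ('n \<Rightarrow> real^'d) \<Rightarrow> complex^'n^'n^'d \<Rightarrow> bool" where
  "jointly_diagonalizes U x S \<longleftrightarrow> unitary_matrix U \<and>
     (\<forall>r. S $ r = U ** diag_matrix (\<lambda>i. x i $ r) ** adjoint_matrix U)"

text \<open>The next two notions do not depend on the choice of the diagonalization; see
  \<open>joint_spectrum_eq\<close> and \<open>matrix_function_eq\<close> below.\<close>

definition joint_spectrum :: "complex^'n^'n^'d \<Rightarrow> (real^'d) set" where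
  "joint_spectrum S = {x i | U x i. jointly_diagonalizes U x S}"

definition matrix_function ::
    "(real^'d \<Rightarrow> real) \<Rightarrow> complex^'n^'n^'d \<Rightarrow> complex^'n^'n" where
  "matrix_function f S = (THE A. \<exists>U x. jointly_diagonalizes U x S \<and>
     A = U ** diag_matrix (\<lambda>i. f (x i)) ** adjoint_matrix U)"

text \<open>The derivative is taken within \<open>I\<close>, hence one-sided at an endpoint belonging to \<open>I\<close>.\<close>

definition C1_curve_on :: "real set \<Rightarrow> (real \<Rightarrow> 'a::real_normed_vector) \<Rightarrow> bool" where
  "C1_curve_on I c \<longleftrightarrow> (\<exists>c'. (\<forall>t\<in>I. (c has_vector_derivative c' t) (at t within I)) \<and>
     continuous_on I c')"

text \<open>Intended for open sets only; the derivative is a bounded linear map, so that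
  continuity of the derivative refers to the operator norm.\<close>

definition C1_function_on :: "('a::real_normed_vector) set \<Rightarrow> ('a \<Rightarrow> 'b::real_normed_vector) \<Rightarrow> bool" where
  "C1_function_on \<Omega> f \<longleftrightarrow> (\<exists>f' :: 'a \<Rightarrow> 'a \<Rightarrow>\<^sub>L 'b.
     (\<forall>x\<in>\<Omega>. (f has_derivative blinfun_apply (f' x)) (at x)) \<and> continuous_on \<Omega> f')"

lemma diag_matrix_mult_left: "(diag_matrix a ** M) $ i $ j = complex_of_real (a i) * M $ i $ j"
  by (simp add: diag_matrix_def matrix_matrix_mult_def if_distrib[of "\<lambda>z. z * _"] cong: if_cong)

lemma diag_matrix_mult_right: "(M ** diag_matrix a) $ i $ j = M $ i $ j * complex_of_real (a j)"
  by (simp add: diag_matrix_def matrix_matrix_mult_def if_distrib[of "\<lambda>z. _ * z"] cong: if_cong)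

lemma unitary_conj_eq_iff:
  assumes U: "unitary_matrix U" and V: "unitary_matrix V"
  shows "U ** A ** adjoint_matrix U = V ** B ** adjoint_matrix V \<longleftrightarrow>
         (adjoint_matrix V ** U) ** A = B ** (adjoint_matrix V ** U)"
    (is "?L \<longleftrightarrow> ?R")
proof
  assume ?L
  then have "adjoint_matrix V ** (U ** A ** adjoint_matrix U) ** U =
      adjoint_matrix V ** (V ** B ** adjoint_matrix V) ** U" by simp
  moreover have "adjoint_matrix V ** (U ** A ** adjoint_matrix U) ** U =
      adjoint_matrix V ** U ** A ** (adjoint_matrix U ** U)"
    by (simp only: matrix_mul_assoc)
  moreover have "adjoint_matrix V ** (V ** B ** adjoint_matrix V) ** U =
      (adjoint_matrix V ** V) ** B ** (adjoint_matrix V ** U)"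
    by (simp only: matrix_mul_assoc)
  ultimately show ?R using U V by (simp add: unitary_matrix_def)
next
  assume ?R
  then have "V ** ((adjoint_matrix V ** U) ** A) ** adjoint_matrix U =
      V ** (B ** (adjoint_matrix V ** U)) ** adjoint_matrix U" by simp
  moreover have "V ** ((adjoint_matrix V ** U) ** A) ** adjoint_matrix U =
      (V ** adjoint_matrix V) ** U ** A ** adjoint_matrix U"
    by (simp only: matrix_mul_assoc)
  moreover have "V ** (B ** (adjoint_matrix V ** U)) ** adjoint_matrix U =
      V ** B ** adjoint_matrix V ** (U ** adjoint_matrix U)"
    by (simp only: matrix_mul_assoc)
  ultimately show ?L using U V by (simp add: unitary_matrix_def)
qed

lemma jointly_diagonalizes_entry:
  assumes S: "jointly_diagonalizes U x S" "jointly_diagonalizes V y S"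
    and nz: "(adjoint_matrix V ** U) $ i $ j \<noteq> 0"
  shows "y i = x j"
proof -
  let ?W = "adjoint_matrix V ** U"
  have "x j $ r = y i $ r" for r
  proof -
    have "?W ** diag_matrix (\<lambda>i. x i $ r) = diag_matrix (\<lambda>i. y i $ r) ** ?W"
      using S unitary_conj_eq_iff unfolding jointly_diagonalizes_def by metis
    then have "?W $ i $ j * complex_of_real (x j $ r) = complex_of_real (y i $ r) * ?W $ i $ j"
      by (metis diag_matrix_mult_left diag_matrix_mult_right)
    with nz show ?thesis by simp
  qed
  then show ?thesis by (simp add: vec_eq_iff)
qed

lemma matrix_function_well_defined:
  assumes S: "jointly_diagonalizes U x S" "jointly_diagonalizes V y S"
  shows "U ** diag_matrix (\<lambda>i. f (x i)) ** adjoint_matrix U =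
         V ** diag_matrix (\<lambda>i. f (y i)) ** adjoint_matrix V"
proof -
  let ?W = "adjoint_matrix V ** U"
  have "(?W ** diag_matrix (\<lambda>i. f (x i))) $ i $ j =
      (diag_matrix (\<lambda>i. f (y i)) ** ?W) $ i $ j" for i j
    using jointly_diagonalizes_entry[OF S, of i j]
    by (cases "?W $ i $ j = 0") (simp_all add: diag_matrix_mult_left diag_matrix_mult_right)
  then have "?W ** diag_matrix (\<lambda>i. f (x i)) = diag_matrix (\<lambda>i. f (y i)) ** ?W"
    by (simp add: vec_eq_iff)
  then show ?thesis
    using S unitary_conj_eq_iff unfolding jointly_diagonalizes_def by blast
qed

lemma matrix_function_eq:
  assumes "jointly_diagonalizes U x S"
  shows "matrix_function f S = U ** diag_matrix (\<lambda>i. f (x i)) ** adjoint_matrix U"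
  unfolding matrix_function_def
proof (rule the_equality)
  show "\<exists>V y. jointly_diagonalizes V y S \<and>
      U ** diag_matrix (\<lambda>i. f (x i)) ** adjoint_matrix U =
      V ** diag_matrix (\<lambda>i. f (y i)) ** adjoint_matrix V"
    using assms by blast
next
  fix A
  assume "\<exists>V y. jointly_diagonalizes V y S \<and>
      A = V ** diag_matrix (\<lambda>i. f (y i)) ** adjoint_matrix V"
  then show "A = U ** diag_matrix (\<lambda>i. f (x i)) ** adjoint_matrix U"
    using matrix_function_well_defined[OF _ assms] by metis
qed

lemma joint_spectrum_eq:
  assumes U: "jointly_diagonalizes U x S"
  shows "joint_spectrum S = range x"
proof -
  have "y i \<in> range x" if V: "jointly_diagonalizes V y S" for V y i
  proof (rule ccontr)
    assume no: "y i \<notin> range x"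
    have "(adjoint_matrix V ** U) $ i $ j = 0" for j
      using jointly_diagonalizes_entry[OF U V, of i j] no by auto
    then have "((adjoint_matrix V ** U) ** (adjoint_matrix U ** V)) $ i $ i = 0"
      by (subst matrix_matrix_mult_def) simp
    moreover have "(adjoint_matrix V ** U) ** (adjoint_matrix U ** V) =
        adjoint_matrix V ** (U ** adjoint_matrix U) ** V"
      by (simp only: matrix_mul_assoc)
    moreover have "adjoint_matrix V ** (U ** adjoint_matrix U) ** V = mat 1"
      using U V by (simp add: jointly_diagonalizes_def unitary_matrix_def)
    ultimately show False by (simp add: mat_def)
  qed
  then show ?thesis using U unfolding joint_spectrum_def by auto
qed

end

theory Submission
  imports Defs
begin

text \<open>
  The idea is to write the increment of the matrix function exactly, in terms of the increment
  of the curve, by an expression whose limit can be read off.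

  On scalars this is Hadamard's lemma: there is a vector-valued function \<open>g\<close>, continuous on
  \<open>\<Omega> \<times> \<Omega>\<close> including the diagonal, with \<open>f y - f x = g (y, x) \<bullet> (y - x)\<close>
  (lemma \<open>hadamard_quotient\<close>). Now let \<open>S\<close> and \<open>R\<close> be two tuples, diagonalized by unitaries
  \<open>V\<close> and \<open>U\<close> with joint eigenvalues \<open>y\<^sub>i\<close> and \<open>x\<^sub>j\<close>, and put \<open>W = V\<^sup>* U\<close>. The matrix
  \<open>V\<^sup>* (F(S) - F(R)) U\<close> has the entries \<open>W\<^sub>i\<^sub>j (f y\<^sub>i - f x\<^sub>j)\<close>, while \<open>V\<^sup>* (S\<^sup>r - R\<^sup>r) U\<close> has the
  entries \<open>W\<^sub>i\<^sub>j (y\<^sub>i\<^sup>r - x\<^sub>j\<^sup>r)\<close>. Multiplying the latter entrywise by the \<open>r\<close>-th component of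
  \<open>g (y\<^sub>i, x\<^sub>j)\<close> and summing over \<open>r\<close> gives the former. Hence \<open>F(S) - F(R) = T(S, R) (S - R)\<close> for the
  linear map \<open>T(S, R)\<close> that passes to the bases given by \<open>V\<close> and \<open>U\<close>, multiplies entrywise by
  \<open>g (y\<^sub>i, x\<^sub>j)\<close>, sums over \<open>r\<close>, and passes back (lemma \<open>matrix_function_diff\<close>). This is a
  double operator integral.

  The unitaries cannot in general be chosen continuously along the curve, but
  \<open>T(S, R)\<close> is independent of the choice (lemma \<open>schur_multiplier_well_defined\<close>) and the unitary
  group is compact. Together these facts make \<open>T(S, R) H\<close> jointly continuous in \<open>S\<close>, \<open>R\<close> and \<open>H\<close>
  (lemma \<open>continuous_on_double_operator_integral\<close>). So the difference quotient
  \<open>T(S(s), S(t)) ((S(s) - S(t)) / (s - t))\<close> tends to \<open>T(S(t), S(t)) (S'(t))\<close> as \<open>s\<close> tends to \<open>t\<close>,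
  and the same continuity shows that this derivative depends continuously on \<open>t\<close>.
\<close>

section \<open>Simultaneous diagonalization of commuting self-adjoint matrices\<close>

text \<open>A unit vector of \<open>W\<close> that maximizes the Rayleigh quotient \<open>T x \<bullet> x\<close> is an eigenvector: the
  gradient of the quotient there lies in \<open>W\<close> and must vanish.\<close>

lemma selfadjoint_eigenvector:
  fixes T :: "'a::euclidean_space \<Rightarrow> 'a"
  assumes lin: "linear T" and sa: "\<And>x y. T x \<bullet> y = x \<bullet> T y"
    and W: "subspace W" and inv: "T ` W \<subseteq> W" and nz: "w \<in> W" "w \<noteq> 0"
  shows "\<exists>l v. v \<in> W \<and> v \<noteq> 0 \<and> T v = l *\<^sub>R v"
proof -
  let ?K = "W \<inter> sphere 0 1"
  have "compact ?K"
    using closed_Int_compact[OF closed_subspace[OF W] compact_sphere] .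
  moreover have "w /\<^sub>R norm w \<in> ?K"
    using nz W by (simp add: subspace_scale)
  moreover have "continuous_on ?K (\<lambda>x. T x \<bullet> x)"
    using linear_continuous_on[of T ?K] lin
    by (intro continuous_intros) (simp add: linear_conv_bounded_linear)
  ultimately obtain v where v: "v \<in> ?K" and max: "\<And>y. y \<in> ?K \<Longrightarrow> T y \<bullet> y \<le> T v \<bullet> v"
    using continuous_attains_sup[of ?K "\<lambda>x. T x \<bullet> x"] by blast
  define l where "l = T v \<bullet> v"
  define q where "q x = l * (x \<bullet> x) - T x \<bullet> x" for x
  have q_nonneg: "0 \<le> q x" if "x \<in> W" for x
  proof (cases "x = 0")
    case False
    have "x /\<^sub>R norm x \<in> ?K"
      using False that W by (simp add: subspace_scale)
    from max[OF this] have "(T x \<bullet> x) / (norm x)^2 \<le> l"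
      using lin by (simp add: linear_scale l_def power2_eq_square divide_inverse mult_ac)
    then show ?thesis
      using False by (simp add: q_def dot_square_norm field_simps)
  qed (simp add: q_def)
  \<comment> \<open>Up to a factor, \<open>z\<close> is the gradient at \<open>v\<close> of the form \<open>q\<close>, which is nonnegative on \<open>W\<close> and
    vanishes at \<open>v\<close>. A short step from \<open>v\<close> against a nonzero gradient would make \<open>q\<close> negative.\<close>
  define z where "z = l *\<^sub>R v - T v"
  have zW: "z \<in> W"
    using v inv W unfolding z_def by (auto intro!: subspace_diff subspace_scale)
  have q_line: "q (v - s *\<^sub>R z) = s^2 * q z - 2 * s * (z \<bullet> z)" for s
  proof -
    have "v \<bullet> v = 1" using v by (simp add: dot_square_norm)
    then have "q v = 0" by (simp add: q_def l_def)
    moreover have "q (v - s *\<^sub>R z) = q v - 2 * s * (l * (v \<bullet> z) - T v \<bullet> z) + s^2 * q z"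
      using lin sa[of z v] unfolding q_def
      by (simp add: linear_diff linear_scale inner_diff_left inner_diff_right inner_commute
          power2_eq_square algebra_simps)
    moreover have "l * (v \<bullet> z) - T v \<bullet> z = z \<bullet> z"
      by (simp add: z_def inner_diff_left)
    ultimately show ?thesis by simp
  qed
  have "z = 0"
  proof (rule ccontr)
    assume "z \<noteq> 0"
    then have pos: "z \<bullet> z > 0" by simp
    \<comment> \<open>Small enough for the linear term of \<open>q_line\<close> to beat the quadratic one; the summand 1 covers
      the case \<open>q z = 0\<close>.\<close>
    define s where "s = (z \<bullet> z) / (q z + 1)"
    have qz: "0 \<le> q z" using q_nonneg zW .
    have s: "s > 0" "s * q z \<le> z \<bullet> z"
      using pos qz by (simp_all add: s_def field_simps)
    have "s * (s * q z) \<le> s * (z \<bullet> z)" using s by (simp add: mult_left_mono)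
    moreover have "s * (z \<bullet> z) > 0" using s pos by simp
    moreover have "0 \<le> q (v - s *\<^sub>R z)"
      using v zW W by (intro q_nonneg) (auto intro!: subspace_diff subspace_scale)
    ultimately show False
      unfolding q_line by (simp add: power2_eq_square mult.assoc)
  qed
  then show ?thesis using v by (intro exI[of _ l] exI[of _ v]) (auto simp: z_def)
qed

text \<open>An eigenspace of one operator within \<open>W\<close> is invariant under the operators that commute with it,
  so \<open>W\<close> can be cut down one operator at a time. Every \<open>T r\<close> leaves \<open>W\<close> invariant, not only
  those with \<open>r \<in> R\<close>, because the induction still has to treat the operators outside \<open>R\<close>.\<close>

lemma commuting_selfadjoint_common_eigenvector:
  fixes T :: "'r \<Rightarrow> 'a::euclidean_space \<Rightarrow> 'a"
  assumes "finite R" and lin: "\<And>r. linear (T r)"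
    and sa: "\<And>r x y. T r x \<bullet> y = x \<bullet> T r y"
    and comm: "\<And>r s x. T r (T s x) = T s (T r x)"
    and "subspace W" "\<And>r. T r ` W \<subseteq> W" "w \<in> W" "w \<noteq> 0"
  shows "\<exists>l v. v \<in> W \<and> v \<noteq> 0 \<and> (\<forall>r\<in>R. T r v = l r *\<^sub>R v)"
  using assms(1,5-)
proof (induction R arbitrary: W w rule: finite_induct)
  case empty
  then show ?case by blast
next
  case (insert r R)
  obtain \<mu> u where u: "u \<in> W" "u \<noteq> 0" "T r u = \<mu> *\<^sub>R u"
    using selfadjoint_eigenvector[OF lin sa insert.prems] by blast
  let ?E = "{x \<in> W. T r x = \<mu> *\<^sub>R x}"
  have "subspace ?E"
    using insert.prems(1) lin[of r]
    by (auto simp: subspace_def linear_add linear_scale linear_0 algebra_simps)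
  moreover have "T s ` ?E \<subseteq> ?E" for s
    using insert.prems(2)[of s] comm[of r s] lin[of s] by (auto simp: linear_scale)
  ultimately obtain l v where v: "v \<in> ?E" "v \<noteq> 0" "\<forall>s\<in>R. T s v = l s *\<^sub>R v"
    using insert.IH[of ?E u] u by blast
  then show ?case
    using insert.hyps by (intro exI[of _ "l(r := \<mu>)"] exI[of _ v]) auto
qed

text \<open>The inner product \<open>\<bullet>\<close> on complex vectors is real-valued, and orthogonality with
  respect to it is too weak for a unitary matrix. The real notions suffice for finding eigenvectors, since
  self-adjoint matrices have real eigenvalues.\<close>

definition cinner :: "complex^'n \<Rightarrow> complex^'n \<Rightarrow> complex" where
  "cinner u v = (\<Sum>i\<in>UNIV. cnj (u $ i) * v $ i)"

lemma Re_cinner: "Re (cinner u v) = u \<bullet> v"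
  by (simp add: cinner_def inner_vec_def inner_complex_def)

lemma cinner_adjoint_matrix: "cinner (A *v u) v = cinner u (adjoint_matrix A *v v)"
proof -
  have "cinner (A *v u) v = (\<Sum>i\<in>UNIV. \<Sum>j\<in>UNIV. cnj (A $ i $ j) * cnj (u $ j) * v $ i)"
    by (simp add: cinner_def matrix_vector_mult_def sum_distrib_right)
  also have "\<dots> = (\<Sum>j\<in>UNIV. \<Sum>i\<in>UNIV. cnj (A $ i $ j) * cnj (u $ j) * v $ i)"
    by (rule sum.swap)
  also have "\<dots> = cinner u (adjoint_matrix A *v v)"
    by (simp add: cinner_def matrix_vector_mult_def sum_distrib_left adjoint_matrix_def mult_ac)
  finally show ?thesis .
qed

lemma linear_cinner: "linear (cinner u)"
  by (rule linearI) (simp_all add: cinner_def algebra_simps sum.distrib scaleR_sum_right)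

lemma cinner_scaleR: "cinner (a *\<^sub>R u) (b *\<^sub>R v) = complex_of_real (a * b) * cinner u v"
  by (simp add: cinner_def sum_distrib_left scaleR_conv_of_real[where 'a=complex] mult_ac)

text \<open>The conditions on \<open>v\<close> form a homogeneous linear system. Padding it with zero rows at the
  indices outside \<open>J\<close> makes it square and singular.\<close>

lemma exists_cinner_orthogonal:
  fixes u :: "'n \<Rightarrow> complex^'n"
  assumes "J \<noteq> UNIV"
  shows "\<exists>v. v \<noteq> 0 \<and> (\<forall>i\<in>J. cinner (u i) v = 0)"
proof -
  obtain j where j: "j \<notin> J" using assms by blast
  define M :: "complex^'n^'n" where "M = (\<chi> i k. if i \<in> J then cnj (u i $ k) else 0)"
  have "B ** M \<noteq> mat 1" for B
  proof
    assume "B ** M = mat 1"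
    then have "(M ** B) $ j $ j = 1"
      using matrix_left_right_inverse[of B M] by (simp add: mat_def)
    then show False using j by (simp add: M_def matrix_matrix_mult_def)
  qed
  then obtain v where v: "M *v v = 0" "v \<noteq> 0"
    using matrix_left_invertible_ker[of M] by blast
  have "cinner (u i) v = 0" if "i \<in> J" for i
  proof -
    have "cinner (u i) v = (M *v v) $ i"
      using that by (simp add: cinner_def M_def matrix_vector_mult_def)
    then show ?thesis using v by simp
  qed
  then show ?thesis using v by blast
qed

text \<open>The orthogonal complement of finitely many common eigenvectors is invariant under all \<open>S $ r\<close>,
  so it contains a further common eigenvector as long as it is not zero.\<close>

lemma commuting_selfadjoint_orthonormal_eigenvectors:
  fixes S :: "complex^'n^'n^'d"
  assumes S: "S \<in> commuting_selfadjoint" and "finite (J :: 'n set)"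
  shows "\<exists>u x. (\<forall>i\<in>J. \<forall>j\<in>J. cinner (u i) (u j) = (if i = j then 1 else 0)) \<and>
    (\<forall>i\<in>J. \<forall>r. S $ r *v u i = (x i $ r) *\<^sub>R u i)"
  using assms(2)
proof (induction J rule: finite_induct)
  case empty
  then show ?case by simp
next
  case (insert j J)
  then obtain u :: "'n \<Rightarrow> complex^'n" and x :: "'n \<Rightarrow> real^'d" where
    on: "\<And>i k. i \<in> J \<Longrightarrow> k \<in> J \<Longrightarrow> cinner (u i) (u k) = (if i = k then 1 else 0)"
    and ev: "\<And>i r. i \<in> J \<Longrightarrow> S $ r *v u i = (x i $ r) *\<^sub>R u i" by blast
  have herm: "adjoint_matrix (S $ r) = S $ r" for r
    using S by (simp add: commuting_selfadjoint_def hermitian_matrix_def)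
  let ?W = "{v. \<forall>i\<in>J. cinner (u i) v = 0}"
  obtain w where "w \<in> ?W" "w \<noteq> 0"
    using exists_cinner_orthogonal[of J u] insert.hyps by blast
  moreover have "subspace ?W"
    by (auto simp: subspace_def linear_0[OF linear_cinner] linear_add[OF linear_cinner]
        linear_scale[OF linear_cinner])
  moreover have "(*v) (S $ r) ` ?W \<subseteq> ?W" for r
  proof -
    have "cinner (u i) (S $ r *v v) = 0" if "i \<in> J" "cinner (u i) v = 0" for i v
    proof -
      have "cinner (u i) (S $ r *v v) = cinner (S $ r *v u i) v"
        by (simp add: cinner_adjoint_matrix herm)
      also have "\<dots> = of_real (x i $ r) * cinner (u i) v"
        unfolding ev[OF that(1)] using cinner_scaleR[of "x i $ r" "u i" 1 v]
        by simp
      finally show ?thesis using that by simp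
    qed
    then show ?thesis by blast
  qed
  moreover have "(S $ r *v a) \<bullet> b = a \<bullet> (S $ r *v b)" for r a b
    by (simp flip: Re_cinner add: cinner_adjoint_matrix herm)
  moreover have "S $ r *v (S $ s *v a) = S $ s *v (S $ r *v a)" for r s a
    using S by (simp add: matrix_vector_mul_assoc commuting_selfadjoint_def)
  ultimately obtain l v where v: "v \<in> ?W" "v \<noteq> 0" "\<And>r. S $ r *v v = l r *\<^sub>R v"
    using commuting_selfadjoint_common_eigenvector[of UNIV "\<lambda>r. (*v) (S $ r)" ?W w] by auto
  define e where "e = v /\<^sub>R norm v"
  have cinner_ev: "cinner v v = of_real ((norm v)\<^sup>2)"
    by (simp add: cinner_def complex_norm_square mult.commute norm_vec_def L2_set_def
        sum_nonneg of_real_sum del: of_real_power)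
  have e_norm: "cinner e e = 1"
  proof -
    have "cinner e e = of_real ((1 / norm v)\<^sup>2) * cinner v v"
      by (simp add: e_def cinner_scaleR power2_eq_square divide_inverse)
    then show ?thesis using v(2) unfolding cinner_ev
      by (simp add: power_divide flip: of_real_power of_real_mult)
  qed
  have e_orth: "cinner (u i) e = 0" "cinner e (u i) = 0" if "i \<in> J" for i
  proof -
    show 1: "cinner (u i) e = 0"
      using v(1) that linear_cinner[of "u i"] by (simp add: e_def linear_scale)
    have "cinner e (u i) = cnj (cinner (u i) e)"
      by (simp add: cinner_def mult.commute)
    then show "cinner e (u i) = 0" using 1 by simp
  qed
  have e_ev: "S $ r *v e = l r *\<^sub>R e" for r
    using v(3)[of r] by (simp add: e_def linear_scale[OF matrix_vector_mul_linear])
  show ?case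
    using insert.hyps on ev e_norm e_orth e_ev
    by (intro exI[of _ "u(j := e)"] exI[of _ "x(j := (\<chi> r. l r))"]) auto
qed

lemma commuting_selfadjoint_diagonalizable:
  fixes S :: "complex^'n^'n^'d"
  assumes "S \<in> commuting_selfadjoint"
  shows "\<exists>U x. jointly_diagonalizes U x S"
proof -
  obtain u :: "'n \<Rightarrow> complex^'n" and x :: "'n \<Rightarrow> real^'d" where
    on: "\<And>i k. cinner (u i) (u k) = (if i = k then 1 else 0)"
    and ev: "\<And>i r. S $ r *v u i = (x i $ r) *\<^sub>R u i"
    using commuting_selfadjoint_orthonormal_eigenvectors[OF assms, of UNIV] by auto
  define U where "U = (\<chi> i j. u j $ i)"
  have "adjoint_matrix U ** U = mat 1"
    using on by (simp add: vec_eq_iff mat_def matrix_matrix_mult_def adjoint_matrix_def U_def cinner_def)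
  then have unitary: "unitary_matrix U"
    using matrix_left_right_inverse unfolding unitary_matrix_def by blast
  have "S $ r = U ** diag_matrix (\<lambda>i. x i $ r) ** adjoint_matrix U" for r
  proof -
    have "(S $ r ** U) $ i $ j = (U ** diag_matrix (\<lambda>i. x i $ r)) $ i $ j" for i j
    proof -
      have "(S $ r ** U) $ i $ j = (S $ r *v u j) $ i"
        by (simp add: matrix_matrix_mult_def matrix_vector_mult_def U_def)
      then show ?thesis
        unfolding ev diag_matrix_mult_right by (simp add: U_def scaleR_conv_of_real[where 'a=complex])
    qed
    then have "S $ r ** U = U ** diag_matrix (\<lambda>i. x i $ r)" by (simp add: vec_eq_iff)
    then have "S $ r ** (U ** adjoint_matrix U) = U ** diag_matrix (\<lambda>i. x i $ r) ** adjoint_matrix U"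
      by (simp add: matrix_mul_assoc)
    then show ?thesis using unitary by (simp add: unitary_matrix_def)
  qed
  with unitary show ?thesis unfolding jointly_diagonalizes_def by blast
qed

section \<open>Hadamard's lemma\<close>

lemma C1_function_gradient:
  fixes f :: "'a::euclidean_space \<Rightarrow> real"
  assumes "C1_function_on \<Omega> f"
  shows "\<exists>G. continuous_on \<Omega> G \<and> (\<forall>x\<in>\<Omega>. (f has_derivative (\<lambda>h. G x \<bullet> h)) (at x))"
proof -
  obtain f' :: "'a \<Rightarrow> 'a \<Rightarrow>\<^sub>L real" where
    f': "\<And>x. x \<in> \<Omega> \<Longrightarrow> (f has_derivative blinfun_apply (f' x)) (at x)" and cont: "continuous_on \<Omega> f'"
    using assms unfolding C1_function_on_def by blast
  define G where "G x = (\<Sum>b\<in>Basis. blinfun_apply (f' x) b *\<^sub>R b)" for x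
  have "blinfun_apply (f' x) h = G x \<bullet> h" for x h
  proof -
    have "blinfun_apply (f' x) h = blinfun_apply (f' x) (\<Sum>b\<in>Basis. (h \<bullet> b) *\<^sub>R b)"
      by (simp add: euclidean_representation)
    also have "\<dots> = G x \<bullet> h"
      by (simp add: G_def blinfun.sum_right blinfun.scaleR_right inner_sum_left inner_commute[of h] mult.commute)
    finally show ?thesis .
  qed
  then have "blinfun_apply (f' x) = (\<lambda>h. G x \<bullet> h)" for x by blast
  moreover have "continuous_on \<Omega> G"
    unfolding G_def by (intro continuous_intros cont)
  ultimately show ?thesis using f' by metis
qed

text \<open>For \<open>y \<noteq> x\<close> the vector \<open>g (y, x)\<close> is the gradient at \<open>x\<close>, corrected along \<open>y - x\<close> by the error of
  the linear approximation. The norm of the correction is that error divided by \<open>norm (y - x)\<close>, and the mean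
  value inequality with the continuity of the gradient makes this small near the diagonal. Compared
  with the mean of the gradient over the segment from \<open>x\<close> to \<open>y\<close>, this choice makes sense
  when the segment leaves \<open>\<Omega>\<close>. The correction makes the identity exact whatever vector takes
  the place of the gradient, so the identity is not confined to points of \<open>\<Omega>\<close>.\<close>

lemma hadamard_quotient:
  fixes f :: "'a::euclidean_space \<Rightarrow> real"
  assumes op: "open \<Omega>" and f: "C1_function_on \<Omega> f"
  shows "\<exists>g. continuous_on (\<Omega> \<times> \<Omega>) g \<and> (\<forall>y x. f y - f x = g (y, x) \<bullet> (y - x))"
proof -
  obtain G where G: "continuous_on \<Omega> G"
    and f': "\<And>x. x \<in> \<Omega> \<Longrightarrow> (f has_derivative (\<lambda>h. G x \<bullet> h)) (at x)"
    using C1_function_gradient[OF f] by blast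
  define \<rho> where "\<rho> y x = (f y - f x - G x \<bullet> (y - x)) / ((y - x) \<bullet> (y - x))" for y x
  define g where "g p = G (snd p) + \<rho> (fst p) (snd p) *\<^sub>R (fst p - snd p)" for p
  have cf: "continuous_on \<Omega> f"
    using has_derivative_continuous_on[OF has_derivative_at_withinI[OF f']] .
  have "continuous (at p) g" if "p \<in> \<Omega> \<times> \<Omega>" for p
  proof (cases "fst p = snd p")
    case False
    let ?D = "(\<Omega> \<times> \<Omega>) \<inter> {p. fst p \<noteq> snd p}"
    have "open ?D"
      using op by (intro open_Int open_Times open_Collect_neq continuous_intros) auto
    moreover have "continuous_on ?D g"
      unfolding g_def \<rho>_def
      by (intro continuous_intros continuous_on_compose2[OF G] continuous_on_compose2[OF cf]) auto
    ultimately show ?thesis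
      using False that continuous_on_eq_continuous_at by blast
  next
    case True
    define z where "z = fst p"
    have p: "p = (z, z)" and z: "z \<in> \<Omega>"
      using True that by (auto simp: z_def prod_eq_iff)
    have gz: "g p = G z" by (simp add: g_def p)
    show ?thesis
      unfolding continuous_at_eps_delta
    proof (intro allI impI)
      fix e :: real assume e: "0 < e"
      \<comment> \<open>One \<open>\<epsilon>\<close> is spent on moving the gradient from \<open>x\<close> to \<open>z\<close>, and two on the correction term;
        the fourth makes the inequality strict.\<close>
      define \<epsilon> where "\<epsilon> = e / 4"
      have "0 < \<epsilon>" using e by (simp add: \<epsilon>_def)
      have "isCont G z"
        using G op z continuous_on_eq_continuous_at by blast
      then obtain d1 where d1: "0 < d1" "\<And>w. dist w z < d1 \<Longrightarrow> dist (G w) (G z) < \<epsilon>"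
        using \<open>0 < \<epsilon>\<close> unfolding continuous_at_eps_delta by blast
      obtain d2 where d2: "0 < d2" "ball z d2 \<subseteq> \<Omega>" using op z open_contains_ball by blast
      define d where "d = min d1 d2"
      have d: "0 < d" using d1 d2 by (simp add: d_def)
      have near: "norm (G w - G z) \<le> \<epsilon>" if "w \<in> ball z d" for w
        using d1(2)[of w] that by (simp add: d_def dist_commute dist_norm)
      have sub: "ball z d \<subseteq> \<Omega>" using d2 by (auto simp: d_def)
      \<comment> \<open>Subtracting the linear function with gradient \<open>G z\<close> leaves a function whose gradient has norm
        at most \<open>\<epsilon>\<close> on the ball.\<close>
      have mvt: "norm ((f y - G z \<bullet> y) - (f x - G z \<bullet> x)) \<le> \<epsilon> * norm (y - x)"
        if "x \<in> ball z d" "y \<in> ball z d" for x y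
      proof (rule differentiable_bound[of "ball z d" "\<lambda>w. f w - G z \<bullet> w" "\<lambda>w h. (G w - G z) \<bullet> h"])
        fix w assume w: "w \<in> ball z d"
        show "((\<lambda>w. f w - G z \<bullet> w) has_derivative (\<lambda>h. (G w - G z) \<bullet> h)) (at w within ball z d)"
          unfolding inner_diff_left
          by (intro has_derivative_diff has_derivative_at_withinI[OF f'] derivative_intros)
            (use sub w in auto)
        show "onorm (\<lambda>h. (G w - G z) \<bullet> h) \<le> \<epsilon>"
        proof (rule onorm_le)
          show "norm ((G w - G z) \<bullet> h) \<le> \<epsilon> * norm h" for h
            using Cauchy_Schwarz_ineq2[of "G w - G z" h] mult_right_mono[OF near[OF w] norm_ge_zero[of h]]
            by simp
        qed
      qed (use that in auto)
      have bound: "norm (g (y, x) - G z) \<le> 3 * \<epsilon>" if xy: "x \<in> ball z d" "y \<in> ball z d" for x y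
      proof -
        have "\<bar>(G z - G x) \<bullet> (y - x)\<bar> \<le> \<epsilon> * norm (y - x)"
          using Cauchy_Schwarz_ineq2[of "G z - G x" "y - x"]
            mult_right_mono[OF near[OF xy(1)] norm_ge_zero[of "y - x"]] by (simp add: norm_minus_commute)
        moreover have "f y - f x - G x \<bullet> (y - x) =
            ((f y - G z \<bullet> y) - (f x - G z \<bullet> x)) + (G z - G x) \<bullet> (y - x)"
          by (simp add: inner_diff_left inner_diff_right)
        ultimately have num: "\<bar>f y - f x - G x \<bullet> (y - x)\<bar> \<le> 2 * \<epsilon> * norm (y - x)"
          using mvt[OF xy] by simp
        have "norm (\<rho> y x *\<^sub>R (y - x)) \<le> 2 * \<epsilon>"
        proof (cases "y = x")
          case False
          then have "norm (\<rho> y x *\<^sub>R (y - x)) = \<bar>f y - f x - G x \<bullet> (y - x)\<bar> / norm (y - x)"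
            by (simp add: \<rho>_def dot_square_norm power2_eq_square)
          also have "\<dots> \<le> 2 * \<epsilon>"
            using num False by (simp add: pos_divide_le_eq)
          finally show ?thesis .
        qed (use \<open>0 < \<epsilon>\<close> in simp)
        then show ?thesis
          using near[OF xy(1)] norm_triangle_ineq[of "G x - G z" "\<rho> y x *\<^sub>R (y - x)"]
          by (simp add: g_def algebra_simps)
      qed
      show "\<exists>d>0. \<forall>q. dist q p < d \<longrightarrow> dist (g q) (g p) < e"
      proof (intro exI[of _ d] conjI allI impI d)
        fix q assume q: "dist q p < d"
        have "dist (fst q) z < d" "dist (snd q) z < d"
          using dist_fst_le[of q p] dist_snd_le[of q p] q by (simp_all add: p)
        then have "norm (g (fst q, snd q) - G z) \<le> 3 * \<epsilon>"
          by (intro bound) (simp_all add: dist_commute)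
        then show "dist (g q) (g p) < e"
          using e unfolding gz by (simp add: dist_norm \<epsilon>_def)
      qed
    qed
  qed
  then have "continuous_on (\<Omega> \<times> \<Omega>) g" by (simp add: continuous_at_imp_continuous_on)
  moreover have "f y - f x = g (y, x) \<bullet> (y - x)" for y x
    by (cases "y = x") (simp_all add: g_def \<rho>_def inner_add_left)
  ultimately show ?thesis by blast
qed

section \<open>The increment of a matrix function as a double operator integral\<close>

text \<open>Reading the joint eigenvalues off the diagonal makes them continuous functions of \<open>U\<close> and \<open>S\<close>,
  which leaves \<open>U\<close> as the only datum of a diagonalization that has to be chosen.\<close>

definition joint_eigenvalue :: "complex^'n^'n \<Rightarrow> complex^'n^'n^'d \<Rightarrow> 'n \<Rightarrow> real^'d" where
  "joint_eigenvalue U S i = (\<chi> r. Re ((adjoint_matrix U ** S $ r ** U) $ i $ i))"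

lemma joint_eigenvalue_eq:
  assumes "jointly_diagonalizes U x S"
  shows "joint_eigenvalue U S = x"
proof
  fix i
  have "adjoint_matrix U ** S $ r ** U = diag_matrix (\<lambda>i. x i $ r)" for r
  proof -
    have "adjoint_matrix U ** S $ r ** U =
        (adjoint_matrix U ** U) ** diag_matrix (\<lambda>i. x i $ r) ** (adjoint_matrix U ** U)"
      using assms by (simp add: jointly_diagonalizes_def matrix_mul_assoc)
    then show ?thesis using assms by (simp add: jointly_diagonalizes_def unitary_matrix_def)
  qed
  then show "joint_eigenvalue U S i = x i"
    by (simp add: joint_eigenvalue_def diag_matrix_def vec_eq_iff)
qed

definition schur_multiplier ::
    "((real^'d) \<times> (real^'d) \<Rightarrow> real^'d) \<Rightarrow> complex^'n^'n \<Rightarrow> ('n \<Rightarrow> real^'d) \<Rightarrow>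
      complex^'n^'n \<Rightarrow> ('n \<Rightarrow> real^'d) \<Rightarrow> complex^'n^'n^'d \<Rightarrow> complex^'n^'n" where
  "schur_multiplier g V y U x H = V **
     (\<chi> i j. \<Sum>r\<in>UNIV. complex_of_real (g (y i, x j) $ r) * (adjoint_matrix V ** H $ r ** U) $ i $ j) **
     adjoint_matrix U"

text \<open>If \<open>P\<^sub>\<mu>\<close> and \<open>Q\<^sub>\<nu>\<close> are the joint spectral projections of \<open>S\<close> and \<open>R\<close>, this is the sum of
  \<open>g\<^sub>r (\<mu>, \<nu>) P\<^sub>\<mu> H\<^sup>r Q\<^sub>\<nu>\<close> over \<open>r\<close> and over the joint eigenvalues \<open>\<mu>\<close> of \<open>S\<close> and \<open>\<nu>\<close> of \<open>R\<close>.\<close>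

definition double_operator_integral ::
    "((real^'d) \<times> (real^'d) \<Rightarrow> real^'d) \<Rightarrow> complex^'n^'n^'d \<Rightarrow> complex^'n^'n^'d \<Rightarrow>
      complex^'n^'n^'d \<Rightarrow> complex^'n^'n" where
  "double_operator_integral g S R H = (THE A. \<exists>V y U x. jointly_diagonalizes V y S \<and>
     jointly_diagonalizes U x R \<and> A = schur_multiplier g V y U x H)"

lemma adjoint_matrix_mult: "adjoint_matrix (A ** B) = adjoint_matrix B ** adjoint_matrix A"
  by (simp add: adjoint_matrix_def matrix_matrix_mult_def vec_eq_iff mult.commute)

lemma adjoint_matrix_adjoint_matrix [simp]: "adjoint_matrix (adjoint_matrix A) = A"
  by (simp add: adjoint_matrix_def vec_eq_iff)

lemma matrix_mult3_entry:
  fixes A :: "'a::semiring_1 ^ 'n ^ 'm" and B :: "'a ^ 'k ^ 'n" and C :: "'a ^ 'l ^ 'k"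
  shows "(A ** B ** C) $ a $ b = (\<Sum>i\<in>UNIV. \<Sum>j\<in>UNIV. A $ a $ i * B $ i $ j * C $ j $ b)"
proof -
  have "(A ** B ** C) $ a $ b = (\<Sum>j\<in>UNIV. \<Sum>i\<in>UNIV. A $ a $ i * B $ i $ j * C $ j $ b)"
    by (simp add: matrix_matrix_mult_def sum_distrib_right)
  also have "\<dots> = (\<Sum>i\<in>UNIV. \<Sum>j\<in>UNIV. A $ a $ i * B $ i $ j * C $ j $ b)"
    by (rule sum.swap)
  finally show ?thesis .
qed

text \<open>The matrices \<open>P\<close> and \<open>Q\<close> of the changes of basis link only indices that carry the same joint
  eigenvalue. Hence the scalar \<open>g (y i, x j)\<close> can be carried through them.\<close>

lemma schur_multiplier_well_defined:
  assumes V: "jointly_diagonalizes V y S" "jointly_diagonalizes V' y' S"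
    and U: "jointly_diagonalizes U x R" "jointly_diagonalizes U' x' R"
  shows "schur_multiplier g V y U x H = schur_multiplier g V' y' U' x' H"
proof -
  define P where "P = adjoint_matrix V' ** V"
  define Q where "Q = adjoint_matrix U' ** U"
  define B where "B = (\<chi> i j. \<Sum>r\<in>UNIV. complex_of_real (g (y i, x j) $ r) *
    (adjoint_matrix V ** H $ r ** U) $ i $ j)"
  define B' where "B' = (\<chi> i j. \<Sum>r\<in>UNIV. complex_of_real (g (y' i, x' j) $ r) *
    (adjoint_matrix V' ** H $ r ** U') $ i $ j)"
  have un: "V ** adjoint_matrix V = mat 1" "U ** adjoint_matrix U = mat 1"
    "V' ** adjoint_matrix V' = mat 1" "U' ** adjoint_matrix U' = mat 1"
    using V U by (simp_all add: jointly_diagonalizes_def unitary_matrix_def)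
  have change: "adjoint_matrix V' ** H $ r ** U' =
      P ** (adjoint_matrix V ** H $ r ** U) ** adjoint_matrix Q" for r
  proof -
    have "P ** (adjoint_matrix V ** H $ r ** U) ** adjoint_matrix Q =
        adjoint_matrix V' ** (V ** adjoint_matrix V) ** H $ r ** (U ** adjoint_matrix U) ** U'"
      unfolding P_def Q_def adjoint_matrix_mult adjoint_matrix_adjoint_matrix
      by (simp only: matrix_mul_assoc)
    then show ?thesis by (simp add: un)
  qed
  have "(P ** B ** adjoint_matrix Q) $ a $ b = B' $ a $ b" for a b
  proof -
    let ?M = "\<lambda>r. adjoint_matrix V ** H $ r ** U"
    have eq: "P $ a $ i * adjoint_matrix Q $ j $ b * complex_of_real (g (y i, x j) $ r) =
        P $ a $ i * adjoint_matrix Q $ j $ b * complex_of_real (g (y' a, x' b) $ r)" for i j r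
      using jointly_diagonalizes_entry[OF V, of a i] jointly_diagonalizes_entry[OF U, of b j]
      unfolding P_def Q_def
      by (cases "(adjoint_matrix V' ** V) $ a $ i = 0"; cases "(adjoint_matrix U' ** U) $ b $ j = 0")
        (simp_all add: adjoint_matrix_def)
    have "(P ** B ** adjoint_matrix Q) $ a $ b = (\<Sum>i\<in>UNIV. \<Sum>j\<in>UNIV. \<Sum>r\<in>UNIV.
        (P $ a $ i * adjoint_matrix Q $ j $ b * complex_of_real (g (y i, x j) $ r)) * ?M r $ i $ j)"
      unfolding matrix_mult3_entry[of P] by (simp add: B_def sum_distrib_left sum_distrib_right mult_ac)
    also have "\<dots> = (\<Sum>i\<in>UNIV. \<Sum>j\<in>UNIV. \<Sum>r\<in>UNIV.
        complex_of_real (g (y' a, x' b) $ r) * (P $ a $ i * ?M r $ i $ j * adjoint_matrix Q $ j $ b))"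
      unfolding eq by (simp add: mult_ac)
    also have "\<dots> = (\<Sum>i\<in>UNIV. \<Sum>r\<in>UNIV. \<Sum>j\<in>UNIV.
        complex_of_real (g (y' a, x' b) $ r) * (P $ a $ i * ?M r $ i $ j * adjoint_matrix Q $ j $ b))"
      by (intro sum.cong refl sum.swap)
    also have "\<dots> = (\<Sum>r\<in>UNIV. \<Sum>i\<in>UNIV. \<Sum>j\<in>UNIV.
        complex_of_real (g (y' a, x' b) $ r) * (P $ a $ i * ?M r $ i $ j * adjoint_matrix Q $ j $ b))"
      by (rule sum.swap)
    also have "\<dots> = B' $ a $ b"
      unfolding B'_def change by (simp add: matrix_mult3_entry[of P] sum_distrib_left)
    finally show ?thesis .
  qed
  then have "P ** B ** adjoint_matrix Q = B'" by (simp add: vec_eq_iff)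
  then have "schur_multiplier g V' y' U' x' H = V' ** (P ** B ** adjoint_matrix Q) ** adjoint_matrix U'"
    by (simp add: schur_multiplier_def B'_def)
  also have "\<dots> = (V' ** adjoint_matrix V') ** V ** B ** adjoint_matrix U ** (U' ** adjoint_matrix U')"
    unfolding P_def Q_def adjoint_matrix_mult adjoint_matrix_adjoint_matrix
    by (simp only: matrix_mul_assoc)
  also have "\<dots> = schur_multiplier g V y U x H"
    by (simp add: un schur_multiplier_def B_def)
  finally show ?thesis by simp
qed

lemma double_operator_integral_eq:
  assumes "jointly_diagonalizes V y S" "jointly_diagonalizes U x R"
  shows "double_operator_integral g S R H = schur_multiplier g V y U x H"
  unfolding double_operator_integral_def
proof (rule the_equality)
  fix A
  assume "\<exists>V y U x. jointly_diagonalizes V y S \<and> jointly_diagonalizes U x R \<and>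
    A = schur_multiplier g V y U x H"
  then show "A = schur_multiplier g V y U x H"
    using schur_multiplier_well_defined[OF _ assms(1) _ assms(2)] by metis
qed (use assms in blast)

lemma matrix_diff_ldistrib:
  fixes A :: "'a::ring_1 ^ 'n ^ 'm"
  shows "A ** (B - C) = A ** B - A ** C"
  by (simp add: matrix_matrix_mult_def vec_eq_iff right_diff_distrib sum_subtractf)

lemma matrix_diff_rdistrib:
  fixes A :: "'a::ring_1 ^ 'n ^ 'm"
  shows "(A - B) ** C = A ** C - B ** C"
  by (simp add: matrix_matrix_mult_def vec_eq_iff left_diff_distrib sum_subtractf)

text \<open>Between the eigenbases of the two tuples, the differences \<open>S - R\<close> and \<open>F(S) - F(R)\<close> are both given
  by \<open>W = V\<^sup>* U\<close> with entries scaled by differences of eigenvalues and of values of \<open>f\<close>, respectively;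
  the function \<open>g\<close> turns the former scaling into the latter.\<close>

lemma matrix_function_diff:
  fixes S R :: "complex^'n^'n^'d"
  assumes S: "S \<in> commuting_selfadjoint" and R: "R \<in> commuting_selfadjoint"
    and g: "\<And>y x. f y - f x = g (y, x) \<bullet> (y - x)"
  shows "matrix_function f S - matrix_function f R = double_operator_integral g S R (S - R)"
proof -
  obtain V y where V: "jointly_diagonalizes V y S"
    using commuting_selfadjoint_diagonalizable[OF S] by blast
  obtain U x where U: "jointly_diagonalizes U x R"
    using commuting_selfadjoint_diagonalizable[OF R] by blast
  define W where "W = adjoint_matrix V ** U"
  have un: "V ** adjoint_matrix V = mat 1" "U ** adjoint_matrix U = mat 1"
    "adjoint_matrix V ** V = mat 1" "adjoint_matrix U ** U = mat 1"
    using V U by (simp_all add: jointly_diagonalizes_def unitary_matrix_def)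
  have sandwich: "adjoint_matrix V ** (V ** diag_matrix a ** adjoint_matrix V -
      U ** diag_matrix b ** adjoint_matrix U) ** U = diag_matrix a ** W - W ** diag_matrix b" for a b
  proof -
    have "adjoint_matrix V ** (V ** diag_matrix a ** adjoint_matrix V -
        U ** diag_matrix b ** adjoint_matrix U) ** U =
        (adjoint_matrix V ** V) ** diag_matrix a ** (adjoint_matrix V ** U) -
        (adjoint_matrix V ** U) ** diag_matrix b ** (adjoint_matrix U ** U)"
      by (simp only: matrix_diff_ldistrib matrix_diff_rdistrib matrix_mul_assoc)
    then show ?thesis by (simp add: un W_def)
  qed
  let ?D = "matrix_function f S - matrix_function f R"
  have "(adjoint_matrix V ** ?D ** U) $ i $ j = (\<Sum>r\<in>UNIV. complex_of_real (g (y i, x j) $ r) *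
      (adjoint_matrix V ** (S - R) $ r ** U) $ i $ j)" for i j
  proof -
    have "(adjoint_matrix V ** (S - R) $ r ** U) $ i $ j =
        complex_of_real (y i $ r - x j $ r) * W $ i $ j" for r
    proof -
      have diff: "(S - R) $ r = V ** diag_matrix (\<lambda>i. y i $ r) ** adjoint_matrix V -
          U ** diag_matrix (\<lambda>i. x i $ r) ** adjoint_matrix U"
        using V U unfolding jointly_diagonalizes_def vector_minus_component by metis
      show ?thesis
        unfolding diff sandwich
        by (simp add: diag_matrix_mult_left diag_matrix_mult_right algebra_simps)
    qed
    then have "(\<Sum>r\<in>UNIV. complex_of_real (g (y i, x j) $ r) *
        (adjoint_matrix V ** (S - R) $ r ** U) $ i $ j) =
        complex_of_real (g (y i, x j) \<bullet> (y i - x j)) * W $ i $ j"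
      by (simp add: inner_vec_def sum_distrib_right mult.assoc)
    also have "\<dots> = (adjoint_matrix V ** ?D ** U) $ i $ j"
      unfolding matrix_function_eq[OF V] matrix_function_eq[OF U] sandwich g[symmetric]
      by (simp add: diag_matrix_mult_left diag_matrix_mult_right algebra_simps)
    finally show ?thesis by simp
  qed
  then have "(\<chi> i j. \<Sum>r\<in>UNIV. complex_of_real (g (y i, x j) $ r) *
      (adjoint_matrix V ** (S - R) $ r ** U) $ i $ j) = adjoint_matrix V ** ?D ** U"
    by (simp add: vec_eq_iff)
  then have "double_operator_integral g S R (S - R) =
      V ** (adjoint_matrix V ** ?D ** U) ** adjoint_matrix U"
    unfolding double_operator_integral_eq[OF V U] schur_multiplier_def by simp
  also have "\<dots> = (V ** adjoint_matrix V) ** ?D ** (U ** adjoint_matrix U)"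
    by (simp only: matrix_mul_assoc)
  finally show ?thesis by (simp add: un)
qed

lemma double_operator_integral_scaleR:
  assumes S: "S \<in> commuting_selfadjoint" and R: "R \<in> commuting_selfadjoint"
  shows "double_operator_integral g S R (c *\<^sub>R H) = c *\<^sub>R double_operator_integral g S R H"
proof -
  obtain V y where V: "jointly_diagonalizes V y S"
    using commuting_selfadjoint_diagonalizable[OF S] by blast
  obtain U x where U: "jointly_diagonalizes U x R"
    using commuting_selfadjoint_diagonalizable[OF R] by blast
  have schur_entries: "(\<chi> i j. \<Sum>r\<in>UNIV. complex_of_real (g (y i, x j) $ r) *
      (adjoint_matrix V ** (c *\<^sub>R H) $ r ** U) $ i $ j) =
    c *\<^sub>R (\<chi> i j. \<Sum>r\<in>UNIV. complex_of_real (g (y i, x j) $ r) *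
      (adjoint_matrix V ** H $ r ** U) $ i $ j)"
    by (simp add: vec_eq_iff matrix_scalar_ac scaleR_sum_right flip: scalar_matrix_assoc)
  show ?thesis
    unfolding double_operator_integral_eq[OF V U] schur_multiplier_def
      schur_entries matrix_scalar_ac scalar_matrix_assoc ..
qed

section \<open>Continuity of the double operator integral\<close>

text \<open>To see that a function computed from an auxiliary choice \<open>u\<close> is continuous, no continuous
  selection of \<open>u\<close> is needed if the result is independent of \<open>u\<close>: the preimage of a
  closed set is the projection of a closed set along the compact factor \<open>C\<close>.\<close>

lemma continuous_on_from_compact_fibres:
  fixes \<Phi> :: "'b::euclidean_space \<Rightarrow> 'c::topological_space"
    and \<Psi> :: "('a::euclidean_space) \<times> 'b \<Rightarrow> 'c"
  assumes C: "compact C" and G: "closedin (top_of_set (C \<times> P)) G"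
    and cont: "continuous_on G \<Psi>"
    and ex: "\<And>p. p \<in> P \<Longrightarrow> \<exists>u. (u, p) \<in> G"
    and eq: "\<And>u p. (u, p) \<in> G \<Longrightarrow> \<Phi> p = \<Psi> (u, p)"
  shows "continuous_on P \<Phi>"
  unfolding continuous_closedin_preimage_eq
proof (intro allI impI)
  fix B :: "'c set" assume "closed B"
  have sub: "G \<subseteq> C \<times> P" using G closedin_imp_subset by blast
  have "closedin (top_of_set (C \<times> P)) (G \<inter> \<Psi> -` B)"
    using continuous_closedin_preimage[OF cont \<open>closed B\<close>] G closedin_trans by blast
  then have "closedin (top_of_set P) {p. \<exists>u. u \<in> C \<and> (u, p) \<in> G \<inter> \<Psi> -` B}"
    by (rule closedin_compact_projection[OF C])
  moreover have "{p. \<exists>u. u \<in> C \<and> (u, p) \<in> G \<inter> \<Psi> -` B} = P \<inter> \<Phi> -` B"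
    using sub ex by (auto dest: eq) (metis SigmaD1 eq subsetD)
  ultimately show "closedin (top_of_set P) (P \<inter> \<Phi> -` B)" by simp
qed

lemma continuous_on_matrix_mult [continuous_intros]:
  fixes A :: "_ \<Rightarrow> 'a::real_normed_algebra_1 ^ 'n ^ 'm" and B :: "_ \<Rightarrow> 'a ^ 'k ^ 'n"
  assumes "continuous_on X A" "continuous_on X B"
  shows "continuous_on X (\<lambda>x. A x ** B x)"
  unfolding matrix_matrix_mult_def by (intro continuous_intros assms)

lemma continuous_on_adjoint_matrix [continuous_intros]:
  "continuous_on X A \<Longrightarrow> continuous_on X (\<lambda>x. adjoint_matrix (A x))"
  unfolding adjoint_matrix_def by (intro continuous_intros)

lemma continuous_on_diag_matrix [continuous_intros]:
  assumes "\<And>i. continuous_on X (\<lambda>x. a x i)"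
  shows "continuous_on X (\<lambda>x. diag_matrix (a x))"
proof -
  have "continuous_on X (\<lambda>x. if i = j then complex_of_real (a x i) else 0)" for i j
    by (cases "i = j") (auto intro!: continuous_intros assms)
  then show ?thesis unfolding diag_matrix_def by (intro continuous_intros)
qed

lemma continuous_on_joint_eigenvalue [continuous_intros]:
  assumes "continuous_on X U" "continuous_on X S"
  shows "continuous_on X (\<lambda>x. joint_eigenvalue (U x) (S x) i)"
  unfolding joint_eigenvalue_def by (intro continuous_intros assms)

lemma compact_unitary_matrix: "compact {U :: complex^'n^'n. unitary_matrix U}"
  unfolding compact_eq_bounded_closed
proof
  have "norm U \<le> sqrt (real CARD('n))" if U: "unitary_matrix U" for U :: "complex^'n^'n"
  proof -
    have "norm (U $ i) = 1" for i
    proof -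
      have "complex_of_real ((norm (U $ i))\<^sup>2) = (U ** adjoint_matrix U) $ i $ i"
        by (simp add: matrix_matrix_mult_def adjoint_matrix_def complex_norm_square norm_vec_def
            L2_set_def sum_nonneg of_real_sum del: of_real_power)
      also have "\<dots> = 1" using U by (simp add: unitary_matrix_def mat_def)
      finally have "(norm (U $ i))\<^sup>2 = 1" using of_real_eq_1_iff by blast
      then show ?thesis using norm_ge_zero[of "U $ i"] by (simp add: power2_eq_1_iff)
    qed
    then show ?thesis by (simp add: norm_vec_def[of U] L2_set_def)
  qed
  then show "bounded {U :: complex^'n^'n. unitary_matrix U}"
    unfolding bounded_iff by blast
  show "closed {U :: complex^'n^'n. unitary_matrix U}"
    unfolding unitary_matrix_def
    by (intro closed_Collect_conj closed_Collect_eq continuous_intros)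
qed

text \<open>Here the auxiliary choice is a pair of diagonalizing unitaries. The graph \<open>?G\<close> of the relation
  between the unitaries and the tuples that they diagonalize is closed, because the
  eigenvalues are continuous functions of the two.\<close>

lemma continuous_on_double_operator_integral:
  fixes g :: "(real^'d) \<times> (real^'d) \<Rightarrow> real^'d" and \<Omega> :: "(real^'d) set"
  defines "N \<equiv> {S :: complex^'n^'n^'d. S \<in> commuting_selfadjoint \<and> joint_spectrum S \<subseteq> \<Omega>}"
  assumes g: "continuous_on (\<Omega> \<times> \<Omega>) g"
  shows "continuous_on (N \<times> N \<times> UNIV) (\<lambda>(S, R, H). double_operator_integral g S R H)"
proof -
  let ?C = "{V :: complex^'n^'n. unitary_matrix V}"
  let ?spec = "\<lambda>U S. \<forall>r. S $ r = U ** diag_matrix (\<lambda>i. joint_eigenvalue U S i $ r) ** adjoint_matrix U"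
  let ?P = "N \<times> N \<times> (UNIV :: (complex^'n^'n^'d) set)"
  let ?G = "((?C \<times> ?C) \<times> ?P) \<inter> {z. ?spec (fst (fst z)) (fst (snd z)) \<and>
    ?spec (snd (fst z)) (fst (snd (snd z)))}"
  let ?\<Psi> = "\<lambda>z. schur_multiplier g (fst (fst z)) (joint_eigenvalue (fst (fst z)) (fst (snd z)))
    (snd (fst z)) (joint_eigenvalue (snd (fst z)) (fst (snd (snd z)))) (snd (snd (snd z)))"
  have diag: "jointly_diagonalizes U (joint_eigenvalue U S) S"
    if "unitary_matrix U" "?spec U S" for U :: "complex^'n^'n" and S :: "complex^'n^'n^'d"
    using that by (simp add: jointly_diagonalizes_def)
  have spec_in: "joint_eigenvalue U S i \<in> \<Omega>"
    if "unitary_matrix U" "?spec U S" "joint_spectrum S \<subseteq> \<Omega>"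
    for U :: "complex^'n^'n" and S :: "complex^'n^'n^'d" and i
    using joint_spectrum_eq[OF diag[OF that(1,2)]] that(3) by blast
  show ?thesis
  proof (rule continuous_on_from_compact_fibres[of "?C \<times> ?C" ?P ?G ?\<Psi>])
    show "compact (?C \<times> ?C)"
      by (intro compact_Times compact_unitary_matrix)
    show "closedin (top_of_set ((?C \<times> ?C) \<times> ?P)) ?G"
      by (intro closedin_closed_Int closed_Collect_conj closed_Collect_all closed_Collect_eq
          continuous_intros)
    have "joint_eigenvalue (fst (fst z)) (fst (snd z)) i \<in> \<Omega>"
      "joint_eigenvalue (snd (fst z)) (fst (snd (snd z))) i \<in> \<Omega>" if "z \<in> ?G" for z i
      using that by (auto simp: N_def intro!: spec_in)
    then show "continuous_on ?G ?\<Psi>"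
      unfolding schur_multiplier_def
      by (intro continuous_intros continuous_on_compose2[OF g]) blast
    show "\<exists>u. (u, p) \<in> ?G" if p: "p \<in> ?P" for p
    proof -
      obtain V y where V: "jointly_diagonalizes V y (fst p)"
        using p commuting_selfadjoint_diagonalizable[of "fst p"] by (auto simp: N_def)
      obtain U x where U: "jointly_diagonalizes U x (fst (snd p))"
        using p commuting_selfadjoint_diagonalizable[of "fst (snd p)"] by (auto simp: N_def)
      have "((V, U), p) \<in> ?G"
        using p V U by (simp add: joint_eigenvalue_eq[OF V] joint_eigenvalue_eq[OF U]
            jointly_diagonalizes_def)
      then show ?thesis by blast
    qed
    show "(case p of (S, R, H) \<Rightarrow> double_operator_integral g S R H) = ?\<Psi> (u, p)"
      if "(u, p) \<in> ?G" for u p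
      using that by (auto simp: case_prod_unfold intro!: double_operator_integral_eq diag)
  qed
qed

section \<open>Differentiation along a curve\<close>

lemma has_vector_derivative_iff_difference_quotient:
  "(c has_vector_derivative d) (at t within I) \<longleftrightarrow>
    ((\<lambda>s. (c s - c t) /\<^sub>R (s - t)) \<longlongrightarrow> d) (at t within I)"
proof -
  have "norm ((c s - c t) /\<^sub>R (s - t) - d) = norm ((c s - c t - (s - t) *\<^sub>R d) /\<^sub>R \<bar>s - t\<bar>)"
    if "s \<noteq> t" for s
  proof -
    have "(c s - c t - (s - t) *\<^sub>R d) /\<^sub>R (s - t) = (c s - c t) /\<^sub>R (s - t) - d"
      using that by (simp add: scaleR_diff_right)
    then show ?thesis by (metis abs_inverse norm_scaleR abs_abs)
  qed
  then have "((\<lambda>s. (c s - c t) /\<^sub>R (s - t) - d) \<longlongrightarrow> 0) (at t within I) \<longleftrightarrow>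
      ((\<lambda>s. (c s - c t - (s - t) *\<^sub>R d) /\<^sub>R \<bar>s - t\<bar>) \<longlongrightarrow> 0) (at t within I)"
    by (subst (1 2) tendsto_norm_zero_iff[symmetric], intro Lim_cong_within) auto
  moreover have "((\<lambda>s. (c s - c t) /\<^sub>R (s - t) - d) \<longlongrightarrow> 0) (at t within I) \<longleftrightarrow>
      ((\<lambda>s. (c s - c t) /\<^sub>R (s - t)) \<longlongrightarrow> d) (at t within I)"
    by (rule LIM_zero_iff)
  ultimately show ?thesis
    unfolding has_vector_derivative_def has_derivative_within
    by (simp add: bounded_linear_scaleR_left diff_diff_eq inverse_eq_divide)
qed

lemma matrix_function_has_vector_derivative:
  fixes S :: "real \<Rightarrow> complex^'n^'n^'d"
  assumes S: "\<And>t. t \<in> I \<Longrightarrow> S t \<in> commuting_selfadjoint" "\<And>t. t \<in> I \<Longrightarrow> joint_spectrum (S t) \<subseteq> \<Omega>"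
    and g: "continuous_on (\<Omega> \<times> \<Omega>) g" "\<And>y x. f y - f x = g (y, x) \<bullet> (y - x)"
    and t: "t \<in> I" and S': "(S has_vector_derivative S') (at t within I)"
  shows "((\<lambda>s. matrix_function f (S s)) has_vector_derivative
    double_operator_integral g (S t) (S t) S') (at t within I)"
proof -
  have "(S \<longlongrightarrow> S t) (at t within I)"
    using has_vector_derivative_continuous[OF S'] by (simp add: continuous_within)
  then have lim: "((\<lambda>s. (S s, S t, (S s - S t) /\<^sub>R (s - t))) \<longlongrightarrow> (S t, S t, S')) (at t within I)"
    using S' unfolding has_vector_derivative_iff_difference_quotient by (intro tendsto_intros)
  have "((\<lambda>s. case (S s, S t, (S s - S t) /\<^sub>R (s - t)) of (S, R, H) \<Rightarrow> double_operator_integral g S R H)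
      \<longlongrightarrow> (case (S t, S t, S') of (S, R, H) \<Rightarrow> double_operator_integral g S R H)) (at t within I)"
    by (rule continuous_on_tendsto_compose[OF continuous_on_double_operator_integral[OF g(1)] lim])
      (use S t in \<open>simp_all add: eventually_at_filter\<close>)
  moreover have "double_operator_integral g (S s) (S t) ((S s - S t) /\<^sub>R (s - t)) =
      (matrix_function f (S s) - matrix_function f (S t)) /\<^sub>R (s - t)" if "s \<in> I" for s
    using matrix_function_diff[OF S(1)[OF that] S(1)[OF t], of f g] g(2)
    by (simp add: double_operator_integral_scaleR[OF S(1)[OF that] S(1)[OF t]])
  then have "\<forall>\<^sub>F s in at t within I.
      (case (S s, S t, (S s - S t) /\<^sub>R (s - t)) of (S, R, H) \<Rightarrow> double_operator_integral g S R H) =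
      (matrix_function f (S s) - matrix_function f (S t)) /\<^sub>R (s - t)"
    by (simp add: eventually_at_filter)
  ultimately show ?thesis
    unfolding has_vector_derivative_iff_difference_quotient by (simp add: tendsto_cong)
qed

theorem theorem3p6:
  fixes S :: "real \<Rightarrow> complex^'n^'n^'d"
    and I :: "real set"
    and \<Omega> :: "(real^'d) set"
    and f :: "real^'d \<Rightarrow> real"
  assumes "is_interval I"
    and "\<And>t. t \<in> I \<Longrightarrow> S t \<in> commuting_selfadjoint"
    and "C1_curve_on I S"
    and "open \<Omega>"
    and "\<And>t. t \<in> I \<Longrightarrow> joint_spectrum (S t) \<subseteq> \<Omega>"
    and "C1_function_on \<Omega> f"
  shows "(\<forall>t\<in>I. (\<lambda>s. matrix_function f (S s)) differentiable (at t within I)) \<and>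
    continuous_on I (\<lambda>t. vector_derivative (\<lambda>s. matrix_function f (S s)) (at t within I))"
proof -
  obtain g where g: "continuous_on (\<Omega> \<times> \<Omega>) g" "\<And>y x. f y - f x = g (y, x) \<bullet> (y - x)"
    using hadamard_quotient assms(4,6) by blast
  obtain S' where S': "\<And>t. t \<in> I \<Longrightarrow> (S has_vector_derivative S' t) (at t within I)"
    and cont': "continuous_on I S'"
    using assms(3) unfolding C1_curve_on_def by blast
  let ?D = "\<lambda>t. double_operator_integral g (S t) (S t) (S' t)"
  have deriv: "((\<lambda>s. matrix_function f (S s)) has_vector_derivative ?D t) (at t within I)"
    if "t \<in> I" for t
    using matrix_function_has_vector_derivative assms(2,5) g that S'[OF that] by blast
  have "continuous_on I S"
    using has_vector_derivative_continuous[OF S'] by (simp add: continuous_on_eq_continuous_within)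
  then have "continuous_on I (\<lambda>t. (S t, S t, S' t))"
    using cont' by (intro continuous_on_Pair)
  from continuous_on_compose2[OF continuous_on_double_operator_integral[OF g(1)] this]
  have contD: "continuous_on I ?D"
    using assms(2,5) by (simp add: image_subset_iff)
  have "continuous_on I (\<lambda>t. vector_derivative (\<lambda>s. matrix_function f (S s)) (at t within I))"
  proof (cases "\<exists>a. I = {a}")
    case True
    \<comment> \<open>On a one-point interval \<open>vector_derivative\<close> is an arbitrary value, but continuity is trivial.\<close>
    then show ?thesis by auto
  next
    case False
    have "vector_derivative (\<lambda>s. matrix_function f (S s)) (at t within I) = ?D t" if "t \<in> I" for t
    proof (rule vector_derivative_within[OF _ deriv[OF that]])
      show "at t within I \<noteq> bot"
        using connected_imp_perfect[OF is_interval_connected[OF assms(1)] that] False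
        by (auto simp: trivial_limit_within)
    qed
    then show ?thesis using contD by (simp cong: continuous_on_cong)
  qed
  then show ?thesis using deriv differentiableI_vector by blast
qed

end
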